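(* Let $X$ and $Y$ be L-algebras such that $Y$ operates on $X$ via $\rho$. Let $\mathscr I(X)$ be the lattice of ideals of $X$ and $\rho\mathscr I(X)$ the set of $\rho$-ideals of $X$. Then $$\rho\mathscr I(X)=\{I\in\mathscr I(X)\mid I\rtimes_\rho\{1\}\in\mathscr I(X\rtimes_\rho Y)\}.$$ Moreover, $\rho\mathscr I(X)$ is a complete sublattice of $\mathscr I(X)$, and it is distributive.
   Context: An L-algebra is a set $X$ with a binary operation $\cdot$ and a distinguished element $1$ such that for all $x,y,z\in X$: $1\cdot x=x$ and $x\cdot 1=x\cdot x=1$; $(x\cdot y)\cdot(x\cdot z)=(y\cdot x)\cdot(y\cdot z)$; and $x\cdot y=y\cdot x=1$ implies $x=y$. $\mathrm{End}(X)$ is the set of maps $f:X\to X$ with $f(x\cdot y)=f(x)\cdot f(y)$. An ideal of $X$ is a nonempty subset $I\subseteq X$ such that for all $x\in I$, $y\in X$: (I1) $x\cdot y\in I$ implies $y\in I$; (I2) $y\cdot x\in I$; (I3) $(x\cdot y)\cdot y\in I$; (I4) $y\cdot(x\cdot y)\in I$. $\mathscr I(X)$ denotes the set of ideals of $X$, a complete lattice under inclusion (meet is intersection). An L-algebra $Y$ operates on an L-algebra $X$ via $\rho:Y\to\mathrm{End}(X)$, $u\mapsto\rho_u$, if $\rho_1=\mathrm{id}$ and $\rho_{u\cdot v}\circ\rho_u=\rho_{v\cdot u}\circ\rho_v$ for all $u,v\in Y$. The semidirect product $X\rtimes_\rho Y$ is the L-algebra on $X\times Y$ with operation $(x,u)\cdot(y,v)=(\rho_{u\cdot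 v}(x)\cdot\rho_{v\cdot u}(y),\,u\cdot v)$. An ideal $I$ of $X$ is a $\rho$-ideal if $\rho_v(I)\subseteq I$ for every $v\in Y$. $I\rtimes_\rho\{1\}$ denotes the subset $I\times\{1\}$ of $X\rtimes_\rho Y$. *)

theory Defs
  imports "HOL-Algebra.Complete_Lattice"
begin

record 'a l_alg = "'a partial_object" +
  lop :: "'a \<Rightarrow> 'a \<Rightarrow> 'a" (infixr \<open>\<cdot>\<index>\<close> 70)
  lone :: "'a" (\<open>\<one>\<index>\<close>)

locale l_algebra =
  fixes X :: "('a, 'm) l_alg_scheme" (structure)
  assumes op_closed: "x \<in> carrier X \<Longrightarrow> y \<in> carrier X \<Longrightarrow> x \<cdot> y \<in> carrier X"
    and one_closed: "\<one> \<in> carrier X"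
    and one_op: "x \<in> carrier X \<Longrightarrow> \<one> \<cdot> x = x"
    and op_one: "x \<in> carrier X \<Longrightarrow> x \<cdot> \<one> = \<one>"
    and op_self: "x \<in> carrier X \<Longrightarrow> x \<cdot> x = \<one>"
    and cycloid: "x \<in> carrier X \<Longrightarrow> y \<in> carrier X \<Longrightarrow> z \<in> carrier X \<Longrightarrow>
      (x \<cdot> y) \<cdot> (x \<cdot> z) = (y \<cdot> x) \<cdot> (y \<cdot> z)"
    and antisym: "x \<in> carrier X \<Longrightarrow> y \<in> carrier X \<Longrightarrow>
      x \<cdot> y = \<one> \<Longrightarrow> y \<cdot> x = \<one> \<Longrightarrow> x = y"

text \<open>Values of an endomorphism outside the carrier are irrelevant and left unspecified;
  accordingly, equalities between maps below are required on the carrier only.\<close>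

definition l_End :: "('a, 'm) l_alg_scheme \<Rightarrow> ('a \<Rightarrow> 'a) set"
  where "l_End X = {f \<in> carrier X \<rightarrow> carrier X.
    \<forall>x\<in>carrier X. \<forall>y\<in>carrier X. f (x \<cdot>\<^bsub>X\<^esub> y) = f x \<cdot>\<^bsub>X\<^esub> f y}"

definition l_ideals :: "('a, 'm) l_alg_scheme \<Rightarrow> 'a set set"
  where "l_ideals X = {I. I \<subseteq> carrier X \<and> I \<noteq> {} \<and>
    (\<forall>x\<in>I. \<forall>y\<in>carrier X.
      (x \<cdot>\<^bsub>X\<^esub> y \<in> I \<longrightarrow> y \<in> I) \<and>
      y \<cdot>\<^bsub>X\<^esub> x \<in> I \<and>
      (x \<cdot>\<^bsub>X\<^esub> y) \<cdot>\<^bsub>X\<^esub> y \<in> I \<and>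
      y \<cdot>\<^bsub>X\<^esub> (x \<cdot>\<^bsub>X\<^esub> y) \<in> I)}"

definition l_operates ::
    "('b, 'n) l_alg_scheme \<Rightarrow> ('a, 'm) l_alg_scheme \<Rightarrow> ('b \<Rightarrow> 'a \<Rightarrow> 'a) \<Rightarrow> bool"
  where "l_operates Y X \<rho> \<longleftrightarrow>
    \<rho> \<in> carrier Y \<rightarrow> l_End X \<and>
    (\<forall>x\<in>carrier X. \<rho> \<one>\<^bsub>Y\<^esub> x = x) \<and>
    (\<forall>u\<in>carrier Y. \<forall>v\<in>carrier Y. \<forall>x\<in>carrier X.
      \<rho> (u \<cdot>\<^bsub>Y\<^esub> v) (\<rho> u x) = \<rho> (v \<cdot>\<^bsub>Y\<^esub> u) (\<rho> v x))"

definition semidirect ::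
    "('a, 'm) l_alg_scheme \<Rightarrow> ('b, 'n) l_alg_scheme \<Rightarrow> ('b \<Rightarrow> 'a \<Rightarrow> 'a) \<Rightarrow> ('a \<times> 'b) l_alg"
  where "semidirect X Y \<rho> =
    \<lparr>carrier = carrier X \<times> carrier Y,
     lop = (\<lambda>(x, u) (y, v).
       (\<rho> (u \<cdot>\<^bsub>Y\<^esub> v) x \<cdot>\<^bsub>X\<^esub> \<rho> (v \<cdot>\<^bsub>Y\<^esub> u) y, u \<cdot>\<^bsub>Y\<^esub> v)),
     lone = (\<one>\<^bsub>X\<^esub>, \<one>\<^bsub>Y\<^esub>)\<rparr>"

definition rho_ideals ::
    "('a, 'm) l_alg_scheme \<Rightarrow> ('b, 'n) l_alg_scheme \<Rightarrow> ('b \<Rightarrow> 'a \<Rightarrow> 'a) \<Rightarrow> 'a set set"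
  where "rho_ideals X Y \<rho> = {I \<in> l_ideals X. \<forall>v\<in>carrier Y. \<rho> v ` I \<subseteq> I}"

definition ideal_lattice :: "('a, 'm) l_alg_scheme \<Rightarrow> 'a set gorder"
  where "ideal_lattice X = \<lparr>carrier = l_ideals X, eq = (=), le = (\<subseteq>)\<rparr>"

text \<open>Suprema and infima are those of the ambient lattice; the empty family is included,
  so a complete sublattice contains the top and bottom elements.\<close>

definition complete_sublattice :: "'a set \<Rightarrow> ('a, 'm) gorder_scheme \<Rightarrow> bool"
  where "complete_sublattice S L \<longleftrightarrow> complete_lattice L \<and> S \<subseteq> carrier L \<and>
    (\<forall>A\<subseteq>S. \<Squnion>\<^bsub>L\<^esub>A \<in> S \<and> \<Sqinter>\<^bsub>L\<^esub>A \<in> S)"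

locale distributive_lattice = lattice +
  assumes meet_join_distrib:
    "\<lbrakk>x \<in> carrier L; y \<in> carrier L; z \<in> carrier L\<rbrakk> \<Longrightarrow>
      x \<sqinter> (y \<squnion> z) = (x \<sqinter> y) \<squnion> (x \<sqinter> z)"

lemma semidirect_l_algebra:
  assumes "l_algebra X" "l_algebra Y" "l_operates Y X \<rho>"
  shows "l_algebra (semidirect X Y \<rho>)"
proof -
  interpret X: l_algebra X by fact
  interpret Y: l_algebra Y by fact
  have cl [simp]: "\<rho> u x \<in> carrier X" if "u \<in> carrier Y" "x \<in> carrier X" for u x
    using assms(3) that unfolding l_operates_def l_End_def by blast
  have hom: "\<rho> u (x \<cdot>\<^bsub>X\<^esub> y) = \<rho> u x \<cdot>\<^bsub>X\<^esub> \<rho> u y"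
    if "u \<in> carrier Y" "x \<in> carrier X" "y \<in> carrier X" for u x y
    using assms(3) that unfolding l_operates_def l_End_def by blast
  have id [simp]: "\<rho> \<one>\<^bsub>Y\<^esub> x = x" if "x \<in> carrier X" for x
    using assms(3) that unfolding l_operates_def by blast
  have comm: "\<rho> (u \<cdot>\<^bsub>Y\<^esub> v) (\<rho> u x) = \<rho> (v \<cdot>\<^bsub>Y\<^esub> u) (\<rho> v x)"
    if "u \<in> carrier Y" "v \<in> carrier Y" "x \<in> carrier X" for u v x
    using assms(3) that unfolding l_operates_def by blast
  have one [simp]: "\<rho> u \<one>\<^bsub>X\<^esub> = \<one>\<^bsub>X\<^esub>" if "u \<in> carrier Y" for u
    by (metis X.one_closed X.op_self cl hom that)
  note [simp] = X.op_closed Y.op_closed X.one_closed Y.one_closed X.one_op Y.one_op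
    X.op_one Y.op_one X.op_self Y.op_self
  show ?thesis
  proof (unfold_locales, goal_cases)
    case (6 p q r)
    obtain x u y v z w where pqr: "p = (x, u)" "q = (y, v)" "r = (z, w)"
      by (metis surj_pair)
    then have c: "x \<in> carrier X" "y \<in> carrier X" "z \<in> carrier X"
      "u \<in> carrier Y" "v \<in> carrier Y" "w \<in> carrier Y"
      using 6 by (auto simp: semidirect_def)
    define a b where "a = (u \<cdot>\<^bsub>Y\<^esub> v) \<cdot>\<^bsub>Y\<^esub> (u \<cdot>\<^bsub>Y\<^esub> w)"
      and "b = (v \<cdot>\<^bsub>Y\<^esub> u) \<cdot>\<^bsub>Y\<^esub> (v \<cdot>\<^bsub>Y\<^esub> w)"
    have ab: "a = b" using c Y.cycloid by (simp add: a_def b_def)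
    have e: "(u \<cdot>\<^bsub>Y\<^esub> w) \<cdot>\<^bsub>Y\<^esub> (u \<cdot>\<^bsub>Y\<^esub> v) = (w \<cdot>\<^bsub>Y\<^esub> u) \<cdot>\<^bsub>Y\<^esub> (w \<cdot>\<^bsub>Y\<^esub> v)"
      "(v \<cdot>\<^bsub>Y\<^esub> w) \<cdot>\<^bsub>Y\<^esub> (v \<cdot>\<^bsub>Y\<^esub> u) = (w \<cdot>\<^bsub>Y\<^esub> v) \<cdot>\<^bsub>Y\<^esub> (w \<cdot>\<^bsub>Y\<^esub> u)"
      using c Y.cycloid by auto
    have [simp]: "a \<in> carrier Y" using c by (simp add: a_def)
    define x1 where "x1 = \<rho> a (\<rho> (u \<cdot>\<^bsub>Y\<^esub> v) x)"
    define y1 where "y1 = \<rho> a (\<rho> (v \<cdot>\<^bsub>Y\<^esub> u) y)"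
    define z1 where "z1 = \<rho> ((u \<cdot>\<^bsub>Y\<^esub> w) \<cdot>\<^bsub>Y\<^esub> (u \<cdot>\<^bsub>Y\<^esub> v)) (\<rho> (w \<cdot>\<^bsub>Y\<^esub> u) z)"
    have x2: "\<rho> ((u \<cdot>\<^bsub>Y\<^esub> w) \<cdot>\<^bsub>Y\<^esub> (u \<cdot>\<^bsub>Y\<^esub> v)) (\<rho> (u \<cdot>\<^bsub>Y\<^esub> w) x) = x1"
      unfolding x1_def a_def using c comm by simp
    have y2: "\<rho> ((v \<cdot>\<^bsub>Y\<^esub> w) \<cdot>\<^bsub>Y\<^esub> (v \<cdot>\<^bsub>Y\<^esub> u)) (\<rho> (v \<cdot>\<^bsub>Y\<^esub> w) y) = y1"
      unfolding y1_def ab b_def using c comm by simp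
    have z2: "\<rho> ((v \<cdot>\<^bsub>Y\<^esub> w) \<cdot>\<^bsub>Y\<^esub> (v \<cdot>\<^bsub>Y\<^esub> u)) (\<rho> (w \<cdot>\<^bsub>Y\<^esub> v) z) = z1"
      unfolding z1_def e using c comm by simp
    have carr: "x1 \<in> carrier X" "y1 \<in> carrier X" "z1 \<in> carrier X"
      using c by (simp_all add: x1_def y1_def z1_def)
    have "\<rho> a (\<rho> (u \<cdot>\<^bsub>Y\<^esub> v) x \<cdot>\<^bsub>X\<^esub> \<rho> (v \<cdot>\<^bsub>Y\<^esub> u) y) = x1 \<cdot>\<^bsub>X\<^esub> y1"
      using c by (simp add: hom x1_def y1_def)
    moreover have "\<rho> ((u \<cdot>\<^bsub>Y\<^esub> w) \<cdot>\<^bsub>Y\<^esub> (u \<cdot>\<^bsub>Y\<^esub> v))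
        (\<rho> (u \<cdot>\<^bsub>Y\<^esub> w) x \<cdot>\<^bsub>X\<^esub> \<rho> (w \<cdot>\<^bsub>Y\<^esub> u) z) = x1 \<cdot>\<^bsub>X\<^esub> z1"
      using c x2 by (simp add: hom z1_def)
    moreover have "\<rho> b (\<rho> (v \<cdot>\<^bsub>Y\<^esub> u) y \<cdot>\<^bsub>X\<^esub> \<rho> (u \<cdot>\<^bsub>Y\<^esub> v) x) = y1 \<cdot>\<^bsub>X\<^esub> x1"
      using c by (simp add: hom x1_def y1_def flip: ab)
    moreover have "\<rho> ((v \<cdot>\<^bsub>Y\<^esub> w) \<cdot>\<^bsub>Y\<^esub> (v \<cdot>\<^bsub>Y\<^esub> u))
        (\<rho> (v \<cdot>\<^bsub>Y\<^esub> w) y \<cdot>\<^bsub>X\<^esub> \<rho> (w \<cdot>\<^bsub>Y\<^esub> v) z) = y1 \<cdot>\<^bsub>X\<^esub> z1"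
      using c y2 z2 by (simp add: hom)
    ultimately show ?case
      using X.cycloid[OF carr] ab unfolding a_def b_def pqr
      by (simp add: semidirect_def)
  next
    case (7 p q)
    obtain x u y v where pq: "p = (x, u)" "q = (y, v)"
      by (metis surj_pair)
    then have c: "x \<in> carrier X" "y \<in> carrier X" "u \<in> carrier Y" "v \<in> carrier Y"
      using 7 by (auto simp: semidirect_def)
    have uv: "u \<cdot>\<^bsub>Y\<^esub> v = \<one>\<^bsub>Y\<^esub>" "v \<cdot>\<^bsub>Y\<^esub> u = \<one>\<^bsub>Y\<^esub>"
      using 7 pq by (auto simp: semidirect_def)
    then have "x \<cdot>\<^bsub>X\<^esub> y = \<one>\<^bsub>X\<^esub>" "y \<cdot>\<^bsub>X\<^esub> x = \<one>\<^bsub>X\<^esub>"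
      using 7 pq c by (auto simp: semidirect_def)
    then show ?case using X.antisym Y.antisym c uv pq by auto
  qed (auto simp: semidirect_def)
qed

end

theory Submission
  imports Defs
begin

text \<open>The join of a family of ideals of \<open>X\<close> is the closure \<open>F\<close> of \<open>{\<one>}\<close> under (I1) alone
  along elements \<open>k\<close> of the union: if \<open>k \<cdot> x \<in> F\<close>, then \<open>x \<in> F\<close>. The other ideal axioms
  propagate along this rule because \<open>(x \<cdot> k) \<cdot> (x \<cdot> y) = (k \<cdot> x) \<cdot> (k \<cdot> y)\<close>. Endomorphisms
  preserving each ideal of the family preserve \<open>F\<close>, whence the \<open>\<rho>\<close>-ideals form a complete
  sublattice. For distributivity let \<open>x \<in> A \<inter> (B \<squnion> C)\<close>; if \<open>x\<close> arises from \<open>k \<cdot> x\<close> with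
  \<open>k \<in> B\<close>, say, then inductively \<open>k \<cdot> x\<close> lies in \<open>(A \<inter> B) \<squnion> (A \<inter> C)\<close>, while
  \<open>(k \<cdot> x) \<cdot> x \<in> A \<inter> B\<close> by (I2) and (I3); now (I1) gives \<open>x\<close>.\<close>

section \<open>Ideal axioms as introduction and elimination rules\<close>

lemma l_idealsI:
  assumes "I \<subseteq> carrier X" "I \<noteq> {}"
    and "\<And>x y. x \<in> I \<Longrightarrow> y \<in> carrier X \<Longrightarrow> x \<cdot>\<^bsub>X\<^esub> y \<in> I \<Longrightarrow> y \<in> I"
    and "\<And>x y. x \<in> I \<Longrightarrow> y \<in> carrier X \<Longrightarrow> y \<cdot>\<^bsub>X\<^esub> x \<in> I"
    and "\<And>x y. x \<in> I \<Longrightarrow> y \<in> carrier X \<Longrightarrow> (x \<cdot>\<^bsub>X\<^esub> y) \<cdot>\<^bsub>X\<^esub> y \<in> I"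
    and "\<And>x y. x \<in> I \<Longrightarrow> y \<in> carrier X \<Longrightarrow> y \<cdot>\<^bsub>X\<^esub> (x \<cdot>\<^bsub>X\<^esub> y) \<in> I"
  shows "I \<in> l_ideals X"
  unfolding l_ideals_def mem_Collect_eq
  by (intro conjI ballI impI) (fact assms(1,2) | rule assms(3-); assumption)+

lemma l_idealsD:
  assumes "I \<in> l_ideals X"
  shows ideal_subset: "I \<subseteq> carrier X" and ideal_nonempty: "I \<noteq> {}"
    and ideal_mp: "\<And>x y. x \<in> I \<Longrightarrow> y \<in> carrier X \<Longrightarrow> x \<cdot>\<^bsub>X\<^esub> y \<in> I \<Longrightarrow> y \<in> I"
    and ideal_op: "\<And>x y. x \<in> I \<Longrightarrow> y \<in> carrier X \<Longrightarrow> y \<cdot>\<^bsub>X\<^esub> x \<in> I"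
    and ideal_op_op: "\<And>x y. x \<in> I \<Longrightarrow> y \<in> carrier X \<Longrightarrow> (x \<cdot>\<^bsub>X\<^esub> y) \<cdot>\<^bsub>X\<^esub> y \<in> I"
    and ideal_le_op: "\<And>x y. x \<in> I \<Longrightarrow> y \<in> carrier X \<Longrightarrow> y \<cdot>\<^bsub>X\<^esub> (x \<cdot>\<^bsub>X\<^esub> y) \<in> I"
  by (insert assms, unfold l_ideals_def mem_Collect_eq)
    (elim conjE; (assumption |
      drule (1) bspec, drule (1) bspec, elim conjE, (assumption | drule (1) mp, assumption)))+

section \<open>Joins of ideals as closures under (I1)\<close>

text \<open>Steps go along \<open>k \<in> S\<close> only, so that in each induction \<open>k\<close>
  lies in one ideal of the family, where all ideal axioms are at hand. Starting from
  \<open>\<one>\<close> makes the empty join the least ideal.\<close>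

inductive_set mp_closure :: "('a, 'm) l_alg_scheme \<Rightarrow> 'a set \<Rightarrow> 'a set"
  for X :: "('a, 'm) l_alg_scheme" and S :: "'a set" where
  one: "\<one>\<^bsub>X\<^esub> \<in> mp_closure X S"
| step: "k \<in> S \<Longrightarrow> x \<in> carrier X \<Longrightarrow> k \<cdot>\<^bsub>X\<^esub> x \<in> mp_closure X S \<Longrightarrow> x \<in> mp_closure X S"

context l_algebra
begin

lemma ideal_one: "I \<in> l_ideals X \<Longrightarrow> \<one> \<in> I"
  by (metis ideal_nonempty ideal_op ideal_subset op_self equals0I subsetD)

lemma carrier_ideal: "carrier X \<in> l_ideals X"
  using one_closed by (intro l_idealsI) (auto intro: op_closed)

lemma Inter_ideals:
  assumes "\<I> \<subseteq> l_ideals X" "\<I> \<noteq> {}"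
  shows "\<Inter>\<I> \<in> l_ideals X"
proof (rule l_idealsI)
  show "\<Inter>\<I> \<noteq> {}" using assms ideal_one by blast
qed (use assms in \<open>blast dest: ideal_subset ideal_mp ideal_op ideal_op_op ideal_le_op\<close>)+

lemma mp_closure_carrier: "x \<in> mp_closure X S \<Longrightarrow> x \<in> carrier X"
  by (induction rule: mp_closure.induct) (auto simp: one_closed)

text \<open>As \<open>k \<cdot> k = \<one>\<close>, a single step along \<open>k\<close> reaches
  \<open>k\<close>.\<close>

lemma mp_closure_superset:
  assumes "S \<subseteq> carrier X"
  shows "S \<subseteq> mp_closure X S"
  using assms op_self mp_closure.one mp_closure.step by fastforce

lemma mp_closure_least:
  assumes "I \<in> l_ideals X" "S \<subseteq> I"
  shows "mp_closure X S \<subseteq> I"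
proof
  fix x assume "x \<in> mp_closure X S"
  then show "x \<in> I"
  proof induction
    case one
    show ?case using assms(1) by (rule ideal_one)
  next
    case (step k x)
    show ?case
      using ideal_mp[OF assms(1) _ step.hyps(2) step.IH] step.hyps(1) assms(2) by blast
  qed
qed

text \<open>Each induction is on the first element with \<open>y\<close> arbitrary, since the
  cycloid equation shifts the claim from \<open>x\<close>, \<open>y\<close> to
  \<open>k \<cdot> x\<close>, \<open>k \<cdot> y\<close>. The order matters: (I2) yields (I1), both
  yield transitivity, and this yields (I3) and (I4).\<close>

lemma mp_closure_ideal:
  assumes "\<I> \<subseteq> l_ideals X"
  shows "mp_closure X (\<Union>\<I>) \<in> l_ideals X"
proof -
  let ?S = "\<Union>\<I>"
  let ?F = "mp_closure X ?S"
  have S_carrier: "k \<in> carrier X" if "k \<in> ?S" for k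
    using that assms ideal_subset by blast
  have S_F: "k \<in> ?F" if "k \<in> ?S" for k
    using that mp_closure_superset[of ?S] S_carrier by blast
  \<comment> \<open>Membership in the union itself is needed: below, \<open>y \<cdot> k\<close> is
    the element along which a step is made.\<close>
  have S_op: "y \<cdot> k \<in> ?S" if k: "k \<in> ?S" and y: "y \<in> carrier X" for k y
  proof -
    obtain I where "I \<in> \<I>" "k \<in> I" using k by blast
    then show ?thesis using ideal_op[of I X k y] assms y by blast
  qed
  have S_op_op: "(k \<cdot> y) \<cdot> y \<in> ?F" if k: "k \<in> ?S" and y: "y \<in> carrier X" for k y
  proof -
    obtain I where "I \<in> \<I>" "k \<in> I" using k by blast
    then have "(k \<cdot> y) \<cdot> y \<in> ?S" using ideal_op_op[of I X k y] assms y by blast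
    then show ?thesis by (rule S_F)
  qed
  have S_le_op: "y \<cdot> (k \<cdot> y) \<in> ?F" if k: "k \<in> ?S" and y: "y \<in> carrier X" for k y
  proof -
    obtain I where "I \<in> \<I>" "k \<in> I" using k by blast
    then have "y \<cdot> (k \<cdot> y) \<in> ?S" using ideal_le_op[of I X k y] assms y by blast
    then show ?thesis by (rule S_F)
  qed
  have F_op: "y \<cdot> x \<in> ?F" if "x \<in> ?F" "y \<in> carrier X" for x y
    using that
  proof (induction arbitrary: y)
    case one
    then show ?case by (simp add: op_one mp_closure.one)
  next
    case (step k x)
    have k: "k \<in> carrier X" using step.hyps(1) by (rule S_carrier)
    have "(y \<cdot> k) \<cdot> (y \<cdot> x) = (k \<cdot> y) \<cdot> (k \<cdot> x)"
      using step.prems k step.hyps(2) by (rule cycloid)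
    moreover have "(k \<cdot> y) \<cdot> (k \<cdot> x) \<in> ?F"
      using k step.prems by (intro step.IH op_closed)
    ultimately have "(y \<cdot> k) \<cdot> (y \<cdot> x) \<in> ?F" by simp
    with S_op[OF step.hyps(1) step.prems] op_closed[OF step.prems step.hyps(2)]
    show ?case by (rule mp_closure.step)
  qed
  have F_mp: "y \<in> ?F" if "x \<in> ?F" "y \<in> carrier X" "x \<cdot> y \<in> ?F" for x y
    using that
  proof (induction arbitrary: y)
    case one
    then show ?case by (simp add: one_op)
  next
    case (step k x)
    have k: "k \<in> carrier X" using step.hyps(1) by (rule S_carrier)
    have "(k \<cdot> x) \<cdot> (k \<cdot> y) = (x \<cdot> k) \<cdot> (x \<cdot> y)"
      using k step.hyps(2) step.prems(1) by (rule cycloid)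
    moreover have "(x \<cdot> k) \<cdot> (x \<cdot> y) \<in> ?F"
      using step.prems(2) op_closed[OF step.hyps(2) k] by (rule F_op)
    ultimately have "(k \<cdot> x) \<cdot> (k \<cdot> y) \<in> ?F" by simp
    then have "k \<cdot> y \<in> ?F"
      by (rule step.IH[OF op_closed[OF k step.prems(1)]])
    with step.hyps(1) step.prems(1) show ?case by (rule mp_closure.step)
  qed
  \<comment> \<open>Reading \<open>a \<cdot> b \<in> ?F\<close> as an order modulo the closure,
    transitivity reduces (I3) and (I4) to chains of comparisons.\<close>
  have F_trans: "a \<cdot> c \<in> ?F"
    if "a \<cdot> b \<in> ?F" "b \<cdot> c \<in> ?F" "a \<in> carrier X" "b \<in> carrier X" "c \<in> carrier X" for a b c
  proof (rule F_mp[OF that(1) op_closed[OF that(3,5)]])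
    show "(a \<cdot> b) \<cdot> (a \<cdot> c) \<in> ?F"
      unfolding cycloid[OF that(3-5)] by (rule F_op[OF that(2) op_closed[OF that(4,3)]])
  qed
  have F_op_op: "(x \<cdot> y) \<cdot> y \<in> ?F" if "x \<in> ?F" "y \<in> carrier X" for x y
    using that
  proof (induction arbitrary: y)
    case one
    then show ?case by (simp add: one_op op_self mp_closure.one)
  next
    case (step k x)
    note x = step.hyps(2) and y = step.prems
    have k: "k \<in> carrier X" using step.hyps(1) by (rule S_carrier)
    \<comment> \<open>The chain is \<open>x \<cdot> y\<close>,
      \<open>(x \<cdot> k) \<cdot> (x \<cdot> y)\<close>, \<open>k \<cdot> y\<close>,
      \<open>y\<close>, justified by (I4) for \<open>x \<cdot> k\<close>, the induction hypothesis,
      and (I3) for \<open>k\<close>.\<close>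
    have "(x \<cdot> y) \<cdot> ((x \<cdot> k) \<cdot> (x \<cdot> y)) \<in> ?F"
      using step.hyps(1) x y by (intro S_le_op S_op op_closed)
    moreover have "((k \<cdot> x) \<cdot> (k \<cdot> y)) \<cdot> (k \<cdot> y) \<in> ?F"
      using k y by (intro step.IH op_closed)
    then have "((x \<cdot> k) \<cdot> (x \<cdot> y)) \<cdot> (k \<cdot> y) \<in> ?F"
      unfolding cycloid[OF k x y] .
    ultimately have "(x \<cdot> y) \<cdot> (k \<cdot> y) \<in> ?F"
      by (rule F_trans) (intro op_closed k x y)+
    then show ?case
      using S_op_op[OF step.hyps(1) y] by (rule F_trans) (intro op_closed k x y)+
  qed
  have F_le_op: "y \<cdot> (x \<cdot> y) \<in> ?F" if "x \<in> ?F" "y \<in> carrier X" for x y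
    using that
  proof (induction arbitrary: y)
    case one
    then show ?case by (simp add: one_op op_self mp_closure.one)
  next
    case (step k x)
    note x = step.hyps(2) and y = step.prems
    have k: "k \<in> carrier X" using step.hyps(1) by (rule S_carrier)
    \<comment> \<open>The reversed chain is \<open>y\<close>, \<open>k \<cdot> y\<close>,
      \<open>(x \<cdot> k) \<cdot> (x \<cdot> y)\<close>, \<open>x \<cdot> y\<close>, justified by
      (I4) for \<open>k\<close>, the induction hypothesis, and (I3) for
      \<open>x \<cdot> k\<close>.\<close>
    have "(k \<cdot> y) \<cdot> ((k \<cdot> x) \<cdot> (k \<cdot> y)) \<in> ?F"
      using k y by (intro step.IH op_closed)
    then have "(k \<cdot> y) \<cdot> ((x \<cdot> k) \<cdot> (x \<cdot> y)) \<in> ?F"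
      unfolding cycloid[OF k x y] .
    moreover have "((x \<cdot> k) \<cdot> (x \<cdot> y)) \<cdot> (x \<cdot> y) \<in> ?F"
      using step.hyps(1) x y by (intro S_op_op S_op op_closed)
    ultimately have "(k \<cdot> y) \<cdot> (x \<cdot> y) \<in> ?F"
      by (rule F_trans) (intro op_closed k x y)+
    with S_le_op[OF step.hyps(1) y] show ?case
      by (rule F_trans) (intro op_closed k x y)+
  qed
  show ?thesis
  proof (rule l_idealsI)
    show "?F \<subseteq> carrier X" using mp_closure_carrier by blast
    show "?F \<noteq> {}" using mp_closure.one by blast
  qed (rule F_mp F_op F_op_op F_le_op; assumption)+
qed

section \<open>Distributivity, and the action of endomorphisms on closures\<close>

lemma Int_mp_closure_distrib:
  assumes "A \<in> l_ideals X" "B \<in> l_ideals X" "C \<in> l_ideals X"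
  shows "A \<inter> mp_closure X (B \<union> C) = mp_closure X (A \<inter> B \<union> A \<inter> C)"
proof
  have "{A \<inter> B, A \<inter> C} \<subseteq> l_ideals X"
    using assms Inter_ideals[of "{A, B}"] Inter_ideals[of "{A, C}"] by auto
  then have D: "mp_closure X (A \<inter> B \<union> A \<inter> C) \<in> l_ideals X"
    using mp_closure_ideal[of "{A \<inter> B, A \<inter> C}"] by simp
  have D_superset: "A \<inter> B \<union> A \<inter> C \<subseteq> mp_closure X (A \<inter> B \<union> A \<inter> C)"
    using assms by (intro mp_closure_superset) (auto dest: ideal_subset)
  \<comment> \<open>The condition \<open>x \<in> A\<close> stays inside the induction; (I2) passes
    it on to \<open>k \<cdot> x\<close>.\<close>
  have "x \<in> A \<Longrightarrow> x \<in> mp_closure X (A \<inter> B \<union> A \<inter> C)" if "x \<in> mp_closure X (B \<union> C)" for x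
    using that
  proof induction
    case one
    show ?case by (rule mp_closure.one)
  next
    case (step k x)
    have k: "k \<in> carrier X"
      using step.hyps(1) assms(2,3)[THEN ideal_subset] by blast
    have kx: "k \<cdot> x \<in> A"
      using assms(1) step.prems k by (rule ideal_op)
    have "(k \<cdot> x) \<cdot> x \<in> A"
      using assms(1) step.prems op_closed[OF k step.hyps(2)] by (rule ideal_op)
    moreover have "(k \<cdot> x) \<cdot> x \<in> B \<union> C"
      using step.hyps(1) ideal_op_op[OF assms(2) _ step.hyps(2)]
        ideal_op_op[OF assms(3) _ step.hyps(2)] by blast
    ultimately have "(k \<cdot> x) \<cdot> x \<in> mp_closure X (A \<inter> B \<union> A \<inter> C)"
      using D_superset by blast
    then show ?case by (rule ideal_mp[OF D step.IH[OF kx] step.hyps(2)])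
  qed
  then show "A \<inter> mp_closure X (B \<union> C) \<subseteq> mp_closure X (A \<inter> B \<union> A \<inter> C)"
    by blast
  have BC: "mp_closure X (B \<union> C) \<in> l_ideals X"
    using assms mp_closure_ideal[of "{B, C}"] by simp
  have "B \<union> C \<subseteq> mp_closure X (B \<union> C)"
    using assms by (intro mp_closure_superset) (auto dest: ideal_subset)
  then show "mp_closure X (A \<inter> B \<union> A \<inter> C) \<subseteq> A \<inter> mp_closure X (B \<union> C)"
    using assms(1) BC by (intro Int_greatest mp_closure_least) auto
qed

lemma endomorphism_one: "f \<in> l_End X \<Longrightarrow> f \<one> = \<one>"
  using one_closed op_self unfolding l_End_def by (smt (verit) PiE mem_Collect_eq)

text \<open>An endomorphism carries a step along \<open>k\<close> to a step along
  \<open>f k\<close>, which is again in \<open>S\<close>.\<close>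

lemma endomorphism_mp_closure:
  assumes "f \<in> l_End X" "S \<subseteq> carrier X" "f ` S \<subseteq> S"
  shows "f ` mp_closure X S \<subseteq> mp_closure X S"
proof -
  have "f x \<in> mp_closure X S" if "x \<in> mp_closure X S" for x
    using that
  proof induction
    case one
    then show ?case by (simp add: endomorphism_one assms(1) mp_closure.one)
  next
    case (step k x)
    then have "f (k \<cdot> x) = f k \<cdot> f x" "f x \<in> carrier X" "f k \<in> S"
      using assms unfolding l_End_def by auto
    then show ?case using step.IH mp_closure.step by metis
  qed
  then show ?thesis by blast
qed

end

section \<open>\<open>\<rho>\<close>-ideals and the semidirect product\<close>

text \<open>In the product, \<open>(x, \<one>) \<cdot> (y, v) = (\<rho> v x \<cdot> y, v)\<close>
  and \<open>(y, v) \<cdot> (x, \<one>) = (y \<cdot> \<rho> v x, \<one>)\<close>. Hence, for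
  \<open>\<rho>\<close>-stable \<open>I\<close>, the axioms for \<open>I \<times> {\<one>}\<close>
  reduce to those for \<open>I\<close> at \<open>\<rho> v x\<close>.\<close>

lemma rho_ideals_eq:
  assumes "l_algebra X" and "l_algebra Y" and "l_operates Y X \<rho>"
  shows "rho_ideals X Y \<rho> =
    {I \<in> l_ideals X. I \<times> {\<one>\<^bsub>Y\<^esub>} \<in> l_ideals (semidirect X Y \<rho>)}"
proof -
  interpret X: l_algebra X by fact
  interpret Y: l_algebra Y by fact
  have cl [simp]: "\<rho> u x \<in> carrier X" if "u \<in> carrier Y" "x \<in> carrier X" for u x
    using assms(3) that unfolding l_operates_def l_End_def by blast
  have id [simp]: "\<rho> \<one>\<^bsub>Y\<^esub> x = x" if "x \<in> carrier X" for x
    using assms(3) that unfolding l_operates_def by blast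
  note [simp] = X.op_closed Y.op_closed X.one_closed Y.one_closed X.one_op Y.one_op
    X.op_one Y.op_one X.op_self Y.op_self
  have "(\<forall>v\<in>carrier Y. \<rho> v ` I \<subseteq> I) \<longleftrightarrow> I \<times> {\<one>\<^bsub>Y\<^esub>} \<in> l_ideals (semidirect X Y \<rho>)"
    if I: "I \<in> l_ideals X" for I
  proof
    have I_carrier [simp]: "x \<in> carrier X" if "x \<in> I" for x
      using that I ideal_subset by blast
    {
      assume \<rho>I: "\<forall>v\<in>carrier Y. \<rho> v ` I \<subseteq> I"
      then have \<rho>I' [simp]: "\<rho> v x \<in> I" if "v \<in> carrier Y" "x \<in> I" for v x
        using that by blast
      show "I \<times> {\<one>\<^bsub>Y\<^esub>} \<in> l_ideals (semidirect X Y \<rho>)"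
        using ideal_nonempty[OF I]
        by (intro l_idealsI)
          (auto simp: semidirect_def ideal_op[OF I] ideal_op_op[OF I] ideal_le_op[OF I]
            dest: ideal_mp[OF I])
    next
      assume *: "I \<times> {\<one>\<^bsub>Y\<^esub>} \<in> l_ideals (semidirect X Y \<rho>)"
      show "\<forall>v\<in>carrier Y. \<rho> v ` I \<subseteq> I"
      proof clarify
        fix v x assume v: "v \<in> carrier Y" and x: "x \<in> I"
        \<comment> \<open>This product equals \<open>(\<rho> v x, \<one>)\<close>, so (I2) exhibits
          \<open>\<rho> v x\<close> as an element of \<open>I\<close>.\<close>
        have "(\<one>\<^bsub>X\<^esub>, v) \<cdot>\<^bsub>semidirect X Y \<rho>\<^esub> (x, \<one>\<^bsub>Y\<^esub>) \<in> I \<times> {\<one>\<^bsub>Y\<^esub>}"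
          using v x by (intro ideal_op[OF *]) (auto simp: semidirect_def)
        then show "\<rho> v x \<in> I" using v x by (simp add: semidirect_def)
      qed
    }
  qed
  then show ?thesis unfolding rho_ideals_def by blast
qed

section \<open>Meets and joins of \<open>\<rho>\<close>-ideals\<close>

lemma rho_ideals_Inter:
  assumes "l_algebra X" "\<I> \<subseteq> rho_ideals X Y \<rho>" "\<I> \<noteq> {}"
  shows "\<Inter>\<I> \<in> rho_ideals X Y \<rho>"
  using l_algebra.Inter_ideals[of X \<I>] assms unfolding rho_ideals_def by blast

lemma carrier_rho_ideal:
  assumes "l_algebra X" "l_operates Y X \<rho>"
  shows "carrier X \<in> rho_ideals X Y \<rho>"
  using l_algebra.carrier_ideal[of X] assms
  unfolding rho_ideals_def l_operates_def l_End_def by blast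

lemma rho_ideals_mp_closure:
  assumes "l_algebra X" "l_operates Y X \<rho>" "\<I> \<subseteq> rho_ideals X Y \<rho>"
  shows "mp_closure X (\<Union>\<I>) \<in> rho_ideals X Y \<rho>"
proof -
  interpret X: l_algebra X by fact
  have "\<I> \<subseteq> l_ideals X" using assms(3) unfolding rho_ideals_def by blast
  moreover have "\<rho> v ` mp_closure X (\<Union>\<I>) \<subseteq> mp_closure X (\<Union>\<I>)" if "v \<in> carrier Y" for v
  proof (rule X.endomorphism_mp_closure)
    show "\<rho> v \<in> l_End X" using that assms(2) unfolding l_operates_def by blast
    show "\<Union>\<I> \<subseteq> carrier X" using \<open>\<I> \<subseteq> l_ideals X\<close> ideal_subset by blast
    show "\<rho> v ` \<Union>\<I> \<subseteq> \<Union>\<I>" using that assms(3) unfolding rho_ideals_def by blast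
  qed
  ultimately show ?thesis
    using X.mp_closure_ideal unfolding rho_ideals_def by blast
qed

section \<open>Suprema and infima in families of sets\<close>

text \<open>The common shape of the lattice of ideals and its restriction to
  \<open>\<rho>\<close>-ideals, so that bounds are computed once for both.\<close>

abbreviation inclusion_order :: "'a set set \<Rightarrow> 'a set gorder" where
  "inclusion_order \<S> \<equiv> \<lparr>carrier = \<S>, eq = (=), le = (\<subseteq>)\<rparr>"

lemma partial_order_inclusion: "partial_order (inclusion_order \<S>)"
  by unfold_locales auto

text \<open>The intersection with \<open>\<S>\<close> stems from \<open>Upper\<close>, which
  disregards members of \<open>\<A>\<close> outside the carrier.\<close>

lemma least_inclusion_order_iff:
  "least (inclusion_order \<S>) J (Upper (inclusion_order \<S>) \<A>) \<longleftrightarrow>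
    J \<in> \<S> \<and> (\<forall>A\<in>\<A> \<inter> \<S>. A \<subseteq> J) \<and> (\<forall>K\<in>\<S>. (\<forall>A\<in>\<A> \<inter> \<S>. A \<subseteq> K) \<longrightarrow> J \<subseteq> K)"
  unfolding least_def Upper_def by (simp add: Ball_def) blast

lemma greatest_inclusion_order_iff:
  "greatest (inclusion_order \<S>) J (Lower (inclusion_order \<S>) \<A>) \<longleftrightarrow>
    J \<in> \<S> \<and> (\<forall>A\<in>\<A> \<inter> \<S>. J \<subseteq> A) \<and> (\<forall>K\<in>\<S>. (\<forall>A\<in>\<A> \<inter> \<S>. K \<subseteq> A) \<longrightarrow> K \<subseteq> J)"
  unfolding greatest_def Lower_def by (simp add: Ball_def) blast

text \<open>The supremum is a choice among least upper bounds; antisymmetry makes that choice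
  unique.\<close>

lemma sup_inclusion_order:
  assumes "least (inclusion_order \<S>) J (Upper (inclusion_order \<S>) \<A>)"
  shows "\<Squnion>\<^bsub>inclusion_order \<S>\<^esub>\<A> = J"
  unfolding sup_def
  by (rule some_equality)
    (use assms partial_order.least_unique[OF partial_order_inclusion] in blast)+

lemma inf_inclusion_order:
  assumes "greatest (inclusion_order \<S>) J (Lower (inclusion_order \<S>) \<A>)"
  shows "\<Sqinter>\<^bsub>inclusion_order \<S>\<^esub>\<A> = J"
  unfolding inf_def
  by (rule some_equality)
    (use assms partial_order.greatest_unique[OF partial_order_inclusion] in blast)+

text \<open>The closure lies below every ideal containing the family, hence below every such member
  of \<open>\<S>\<close>.\<close>

lemma least_mp_closure:
  assumes "l_algebra X" "\<S> \<subseteq> l_ideals X" "\<A> \<subseteq> \<S>" "mp_closure X (\<Union>\<A>) \<in> \<S>"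
  shows "least (inclusion_order \<S>) (mp_closure X (\<Union>\<A>)) (Upper (inclusion_order \<S>) \<A>)"
proof -
  have "\<Union>\<A> \<subseteq> mp_closure X (\<Union>\<A>)"
    using assms ideal_subset by (intro l_algebra.mp_closure_superset) blast+
  moreover have "mp_closure X (\<Union>\<A>) \<subseteq> K" if "K \<in> \<S>" "\<Union>\<A> \<subseteq> K" for K
    using assms that by (intro l_algebra.mp_closure_least) blast+
  ultimately show ?thesis
    unfolding least_inclusion_order_iff using assms(3,4) by blast
qed

lemma greatest_Inter:
  assumes "\<A> \<subseteq> \<S>" "\<A> \<noteq> {}" "\<Inter>\<A> \<in> \<S>"
  shows "greatest (inclusion_order \<S>) (\<Inter>\<A>) (Lower (inclusion_order \<S>) \<A>)"
  unfolding greatest_inclusion_order_iff using assms by blast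

text \<open>The empty meet is a separate case because \<open>\<Inter>{}\<close> is
  \<open>UNIV\<close> rather than the carrier.\<close>

lemma greatest_carrier:
  assumes "\<S> \<subseteq> l_ideals X" "carrier X \<in> \<S>"
  shows "greatest (inclusion_order \<S>) (carrier X) (Lower (inclusion_order \<S>) {})"
  unfolding greatest_inclusion_order_iff using assms ideal_subset by blast

section \<open>Completeness, the sublattice property and distributivity\<close>

lemma ideal_lattice_complete:
  assumes "l_algebra X"
  shows "complete_lattice (ideal_lattice X)"
proof -
  interpret X: l_algebra X by fact
  interpret partial_order "inclusion_order (l_ideals X)"
    by (rule partial_order_inclusion)
  show ?thesis
    unfolding ideal_lattice_def
  proof unfold_locales
    fix \<A> assume "\<A> \<subseteq> carrier (inclusion_order (l_ideals X))"
    then have \<A>: "\<A> \<subseteq> l_ideals X" by simp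
    show "\<exists>s. least (inclusion_order (l_ideals X)) s (Upper (inclusion_order (l_ideals X)) \<A>)"
      using least_mp_closure[OF assms order_refl \<A>] X.mp_closure_ideal[OF \<A>] by blast
    show "\<exists>i. greatest (inclusion_order (l_ideals X)) i (Lower (inclusion_order (l_ideals X)) \<A>)"
    proof (cases "\<A> = {}")
      case True
      then show ?thesis using greatest_carrier X.carrier_ideal by blast
    next
      case False
      then show ?thesis using greatest_Inter \<A> X.Inter_ideals by blast
    qed
  qed
qed

lemma rho_ideals_complete_sublattice:
  assumes "l_algebra X" "l_operates Y X \<rho>"
  shows "complete_sublattice (rho_ideals X Y \<rho>) (ideal_lattice X)"
proof -
  interpret X: l_algebra X by fact
  have sub: "rho_ideals X Y \<rho> \<subseteq> l_ideals X"
    unfolding rho_ideals_def by blast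
  have "\<Squnion>\<^bsub>ideal_lattice X\<^esub>\<A> \<in> rho_ideals X Y \<rho> \<and> \<Sqinter>\<^bsub>ideal_lattice X\<^esub>\<A> \<in> rho_ideals X Y \<rho>"
    if \<A>: "\<A> \<subseteq> rho_ideals X Y \<rho>" for \<A>
  proof
    have \<A>': "\<A> \<subseteq> l_ideals X" using \<A> sub by blast
    show "\<Squnion>\<^bsub>ideal_lattice X\<^esub>\<A> \<in> rho_ideals X Y \<rho>"
      using sup_inclusion_order[OF least_mp_closure[OF assms(1) order_refl \<A>'
          X.mp_closure_ideal[OF \<A>']]] rho_ideals_mp_closure[OF assms \<A>]
      by (simp add: ideal_lattice_def)
    show "\<Sqinter>\<^bsub>ideal_lattice X\<^esub>\<A> \<in> rho_ideals X Y \<rho>"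
    proof (cases "\<A> = {}")
      case True
      then show ?thesis
        using inf_inclusion_order[OF greatest_carrier[OF order_refl X.carrier_ideal]]
          carrier_rho_ideal[OF assms]
        by (simp add: ideal_lattice_def)
    next
      case False
      then show ?thesis
        using inf_inclusion_order[OF greatest_Inter[OF \<A>' False X.Inter_ideals[OF \<A>' False]]]
          rho_ideals_Inter[OF assms(1) \<A> False]
        by (simp add: ideal_lattice_def)
    qed
  qed
  then show ?thesis
    using ideal_lattice_complete[OF assms(1)] sub
    unfolding complete_sublattice_def by (simp add: ideal_lattice_def)
qed

text \<open>Joins and meets of \<open>\<rho>\<close>-ideals are the same closures and intersections
  as for ideals, so the identity for ideals of \<open>X\<close> carries over.\<close>

lemma rho_ideals_distributive:
  assumes "l_algebra X" "l_operates Y X \<rho>"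
  shows "distributive_lattice (inclusion_order (rho_ideals X Y \<rho>))"
proof -
  interpret X: l_algebra X by fact
  let ?R = "rho_ideals X Y \<rho>"
  let ?L = "inclusion_order ?R"
  interpret partial_order ?L by (rule partial_order_inclusion)
  have sub: "?R \<subseteq> l_ideals X" unfolding rho_ideals_def by blast
  have R_join: "mp_closure X (A \<union> B) \<in> ?R" if "A \<in> ?R" "B \<in> ?R" for A B
    using rho_ideals_mp_closure[OF assms, of "{A, B}"] that by simp
  have R_meet: "A \<inter> B \<in> ?R" if "A \<in> ?R" "B \<in> ?R" for A B
    using rho_ideals_Inter[OF assms(1), of "{A, B}" Y \<rho>] that by simp
  have least: "least ?L (mp_closure X (A \<union> B)) (Upper ?L {A, B})" if "A \<in> ?R" "B \<in> ?R" for A B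
    using least_mp_closure[OF assms(1) sub, of "{A, B}"] R_join that by simp
  have greatest: "greatest ?L (A \<inter> B) (Lower ?L {A, B})" if "A \<in> ?R" "B \<in> ?R" for A B
    using greatest_Inter[of "{A, B}" ?R] R_meet that by simp
  have join: "A \<squnion>\<^bsub>?L\<^esub> B = mp_closure X (A \<union> B)" if "A \<in> ?R" "B \<in> ?R" for A B
    using sup_inclusion_order[OF least[OF that]] by (simp add: join_def)
  have meet: "A \<sqinter>\<^bsub>?L\<^esub> B = A \<inter> B" if "A \<in> ?R" "B \<in> ?R" for A B
    using inf_inclusion_order[OF greatest[OF that]] by (simp add: meet_def)
  show ?thesis
  proof unfold_locales
    fix A B C assume "A \<in> carrier ?L" "B \<in> carrier ?L" "C \<in> carrier ?L"
    then have ABC: "A \<in> ?R" "B \<in> ?R" "C \<in> ?R" by simp_all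
    then show "A \<sqinter>\<^bsub>?L\<^esub> (B \<squnion>\<^bsub>?L\<^esub> C) = (A \<sqinter>\<^bsub>?L\<^esub> B) \<squnion>\<^bsub>?L\<^esub> (A \<sqinter>\<^bsub>?L\<^esub> C)"
      using sub X.Int_mp_closure_distrib[of A B C]
      by (simp add: join meet R_join R_meet subset_iff)
  qed (auto intro: least greatest exI)
qed

theorem proposition3p15:
  fixes X :: "('a, 'm) l_alg_scheme" and Y :: "('b, 'n) l_alg_scheme"
    and \<rho> :: "'b \<Rightarrow> 'a \<Rightarrow> 'a"
  assumes "l_algebra X" and "l_algebra Y" and "l_operates Y X \<rho>"
  shows "rho_ideals X Y \<rho> =
      {I \<in> l_ideals X. I \<times> {\<one>\<^bsub>Y\<^esub>} \<in> l_ideals (semidirect X Y \<rho>)} \<and>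
    complete_sublattice (rho_ideals X Y \<rho>) (ideal_lattice X) \<and>
    distributive_lattice ((ideal_lattice X)\<lparr>carrier := rho_ideals X Y \<rho>\<rparr>)"
  using rho_ideals_eq[OF assms] rho_ideals_complete_sublattice[OF assms(1,3)]
    rho_ideals_distributive[OF assms(1,3)]
  by (simp add: ideal_lattice_def)

end
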